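(* Let $d\ge 3$ be an odd integer. Let $n\geq 1$ with $\gcd(d,2^n-1)=1$ and let $1\leq r\leq \theta_d-1$ be such that $n\equiv r \pmod{\theta_d}$. Then the following hold. (a) $$\mathrm{Inv}_d(n) = \mathrm{Inv}_d(r)\cdot 2^{n-r} + \left(\frac{d\cdot \mathrm{Inv}_d(r)-1}{2^r-1}-1\right)\cdot\frac{2^{n-r}-1}{d}.$$ (b) $$\mathrm{Inv}_d(n) = \mathrm{Inv}_d(r)\cdot\sum_{i=0}^{m}2^{\theta_d\cdot i} + \left(2^{\theta_d-r}-1-\mathrm{Inv}_d(\theta_d-r)\right)2^r\sum_{i=0}^{m-1}2^{\theta_d\cdot i},$$ where $m=\frac{n-r}{\theta_d}$. Equivalently, $$\mathrm{Inv}_d(n) = \mathrm{Inv}_d(r)\cdot\frac{2^{\theta_d(m+1)}-1}{2^{\theta_d}-1} + \left(2^{\theta_d-r}-1-\mathrm{Inv}_d(\theta_d-r)\right)2^r\cdot\frac{2^{\theta_d m}-1}{2^{\theta_d}-1}.$$ (c) $$\mathrm{Inv}_d(n) = \frac{\mathrm{Inv}_d(r)(2^n-1)-\frac{2^n-2^r}{d}}{2^r-1}.$$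
   Context: For a positive integer $d$ and $n\ge 1$ with $\gcd(d,2^n-1)=1$, $\mathrm{Inv}_d(n)$ denotes the least positive residue of the inverse of $d$ modulo $2^n-1$, i.e. the smallest positive integer $t$ with $d\cdot t\equiv 1 \pmod{2^n-1}$; thus $0<\mathrm{Inv}_d(n)<2^n-1$ for $n\ge 2$, and $\mathrm{Inv}_d(1)=1$. For odd $d\ge 3$, $\theta_d$ denotes the multiplicative order of $2$ modulo $d$. An empty sum is $0$. *)

theory Defs
  imports Complex_Main "HOL-Number_Theory.Number_Theory"
begin

(* The multiplicative order theta_d of 2 modulo d is the library's "ord d 2".
   Inv d n is only meaningful when d is coprime to 2 ^ n - 1 and n >= 1, which
   guarantees that a t as described exists. For n = 1 the modulus is 1, and
   Inv d 1 = 1. *)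
definition Inv :: "nat \<Rightarrow> nat \<Rightarrow> nat" where
  "Inv d n = (LEAST t. 0 < t \<and> [d * t = 1] (mod (2 ^ n - 1)))"

lemma Inv_spec:
  assumes "n \<ge> 1" and "coprime d (2 ^ n - 1)"
  shows "0 < Inv d n" and "[d * Inv d n = 1] (mod (2 ^ n - 1))"
proof -
  obtain t where t: "[d * t = 1] (mod (2 ^ n - 1))"
    using cong_solve_coprime_nat[OF assms(2)] by auto
  have "[d * (t + (2 ^ n - 1)) = d * t] (mod (2 ^ n - 1))"
    unfolding cong_def distrib_left by (rule mod_mult_self1)
  then have "[d * (t + (2 ^ n - 1)) = 1] (mod (2 ^ n - 1))"
    using t cong_trans by blast
  moreover have "0 < t + (2 ^ n - 1)"
    using one_less_power[of "2::nat" n] assms(1) by linarith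
  ultimately have "0 < t + (2 ^ n - 1) \<and> [d * (t + (2 ^ n - 1)) = 1] (mod (2 ^ n - 1))"
    by blast
  then have "0 < Inv d n \<and> [d * Inv d n = 1] (mod (2 ^ n - 1))"
    unfolding Inv_def by (rule LeastI)
  then show "0 < Inv d n" and "[d * Inv d n = 1] (mod (2 ^ n - 1))"
    by auto
qed

lemma Inv_1: "Inv d 1 = 1"
  unfolding Inv_def by (rule Least_equality) auto

end

theory Submission
  imports Defs
begin

text \<open>
  Write \<open>d * Inv d n = 1 + k * (2 ^ n - 1)\<close>. Minimality of the inverse gives
  \<open>0 < k < d\<close>, and reduction modulo \<open>d\<close> gives \<open>k * (2 ^ n - 1) \<equiv> -1\<close>. Hence the
  quotient \<open>k\<close> depends on \<open>n\<close> only through the residue of \<open>2 ^ n\<close> modulo \<open>d\<close>, that is,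
  only through \<open>n\<close> modulo the order \<open>\<theta>\<close> of \<open>2\<close>. So \<open>n\<close> and \<open>r\<close> share the same \<open>k\<close>
  (\<open>inverse_quotient_unique\<close>). Solving the equation for \<open>r\<close> for \<open>k\<close> and
  inserting the result in the equation for \<open>n\<close> gives the first and the last formula.

  For the middle formula the exponent \<open>\<theta> - r\<close> enters. As
  \<open>2 ^ (\<theta> - r)\<close> is the inverse of \<open>2 ^ r\<close> modulo \<open>d\<close>, the quotient \<open>k'\<close> that belongs to
  \<open>\<theta> - r\<close> satisfies \<open>k + k' \<equiv> 1\<close> modulo \<open>d\<close>, and the bounds on \<open>k\<close> and \<open>k'\<close> force
  \<open>k + k' = d + 1\<close> (\<open>inverse_quotient_reflect\<close>). With all three inverses expressed through \<open>k\<close>,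
  this formula, too, is a polynomial identity once its denominators are cleared.
\<close>

section \<open>The quotient belonging to an inverse\<close>

text \<open>The modulus can be subtracted from any larger solution. The bound is attained for
  \<open>n = 1\<close>, where the modulus and the inverse are both \<open>1\<close>.\<close>

lemma Inv_le:
  assumes "n \<ge> 1" and "coprime d (2 ^ n - 1)"
  shows "Inv d n \<le> 2 ^ n - 1"
proof (rule ccontr)
  define M :: nat where "M = 2 ^ n - 1"
  assume "\<not> Inv d n \<le> 2 ^ n - 1"
  then have gt: "M < Inv d n" by (simp add: M_def)
  have "0 < M"
    using one_less_power[of "2::nat" n] assms(1) by (simp add: M_def)
  have "d * Inv d n = d * (Inv d n - M) + d * M"
    using gt by (simp add: diff_mult_distrib2)
  then have "[d * (Inv d n - M) = d * Inv d n] (mod M)"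
    unfolding cong_def by simp
  then have "[d * (Inv d n - M) = 1] (mod M)"
    using Inv_spec(2)[OF assms] cong_trans unfolding M_def by blast
  then have "Inv d n \<le> Inv d n - M"
    using gt unfolding Inv_def M_def by (intro Least_le) auto
  then show False using gt \<open>0 < M\<close> by linarith
qed

text \<open>The strict lower bound on the quotient uses \<open>d > 1\<close>: a zero quotient would mean
  \<open>d * Inv d n = 1\<close>.\<close>

lemma Inv_quotient:
  assumes "d \<ge> 2" and "n \<ge> 1" and "coprime (int d) (2 ^ n - 1)"
  obtains k :: int where "0 < k" and "k < int d"
    and "int d * int (Inv d n) = 1 + k * (2 ^ n - 1)"
proof -
  define M :: nat where "M = 2 ^ n - 1"
  have M: "0 < M" "int M = 2 ^ n - 1"
    using one_less_power[of "2::nat" n] assms(2) by (auto simp: M_def of_nat_diff)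
  have cop: "coprime d (2 ^ n - 1)"
    using assms(3) M(2) unfolding M_def by (metis coprime_int_iff)
  have "[int d * int (Inv d n) = 1] (mod int M)"
    using Inv_spec(2)[OF assms(2) cop] unfolding M_def
    by (metis cong_int_iff of_nat_1 of_nat_mult)
  then obtain k where k: "int d * int (Inv d n) = 1 + k * int M"
    by (metis cong_iff_lin cong_sym mult.commute)
  have "1 * 2 \<le> Inv d n * d"
    using Inv_spec(1)[OF assms(2) cop] assms(1) by (intro mult_le_mono) auto
  then have "int 2 \<le> int (d * Inv d n)"
    unfolding of_nat_le_iff by (simp add: mult.commute)
  then have "0 < k * int M" using k by simp
  then have "0 < k" using M(1) by (simp add: zero_less_mult_iff)
  moreover have "k < int d"
  proof -
    have "int (d * Inv d n) \<le> int (d * M)"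
      unfolding of_nat_le_iff using Inv_le[OF assms(2) cop] by (simp add: M_def)
    then have "k * int M < int d * int M" using k by simp
    then show ?thesis by (simp add: mult_less_cancel_right)
  qed
  ultimately show ?thesis using that k M(2) by simp
qed

text \<open>Both numbers are \<open>-1\<close> times the inverse of the common residue of \<open>x\<close> and \<open>y\<close>
  modulo \<open>d\<close>, and both are reduced modulo \<open>d\<close>.\<close>

lemma inverse_quotient_unique:
  fixes d x y k l t u :: int
  assumes "0 < k" "k < d" "0 < l" "l < d"
    and k: "d * t = 1 + k * x" and l: "d * u = 1 + l * y"
    and xy: "[x = y] (mod d)" and "coprime d x"
  shows "k = l"
proof -
  from xy obtain z where z: "y = x + d * z"
    by (auto simp: cong_iff_lin)
  have "x * (k - l) = d * (t - u + l * z)"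
    using k l unfolding z by (simp add: algebra_simps)
  then have "d dvd x * (k - l)" by (metis dvd_triv_left)
  then have "d dvd k - l"
    using \<open>coprime d x\<close> coprime_dvd_mult_right_iff by blast
  then have "[k = l] (mod d)" by (simp add: cong_iff_dvd_diff)
  then show ?thesis using assms(1-4) cong_less_imp_eq_int by simp
qed

text \<open>With \<open>a\<close> and \<open>b\<close> mutually inverse modulo \<open>d\<close>, multiplying \<open>l * (b - 1) \<equiv> -1\<close>
  by \<open>a\<close> gives \<open>l * (a - 1) \<equiv> a\<close>. Adding \<open>k * (a - 1) \<equiv> -1\<close> and cancelling \<open>a - 1\<close>
  leaves \<open>k + l \<equiv> 1\<close>, whereas \<open>k + l\<close> lies strictly between \<open>1\<close> and \<open>2 * d\<close>.\<close>

lemma inverse_quotient_reflect: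
  fixes d a b k l t u :: int
  assumes "0 < k" "k < d" "0 < l" "l < d"
    and k: "d * t = 1 + k * (a - 1)" and l: "d * u = 1 + l * (b - 1)"
    and ab: "[a * b = 1] (mod d)" and "coprime d (a - 1)"
  shows "k + l = d + 1"
proof -
  from ab obtain z where z: "a * b = 1 + d * z"
    by (metis cong_iff_lin cong_sym)
  have "(a - 1) * (k + l - 1) = (1 + k * (a - 1)) - a * (1 + l * (b - 1)) + l * (a * b - 1)"
    by (simp add: algebra_simps)
  also have "\<dots> = d * (t - a * u + l * z)"
    unfolding k[symmetric] l[symmetric] z by (simp add: algebra_simps)
  finally have "d dvd (a - 1) * (k + l - 1)" by (metis dvd_triv_left)
  then have "d dvd k + l - 1"
    using \<open>coprime d (a - 1)\<close> coprime_dvd_mult_right_iff by blast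
  then obtain c where c: "k + l - 1 = d * c" by (elim dvdE)
  have "0 < d * c" "d * c < d * 2" using c assms(1-4) by linarith+
  then have "0 < c" "c < 2"
    using assms(1,2) by (auto simp: zero_less_mult_iff mult_less_cancel_left)
  then have "c = 1" by linarith
  with c show ?thesis by simp
qed

section \<open>The formulas for the inverse\<close>

theorem theorem3p2:
  fixes d n r :: nat
  assumes "d \<ge> 3" and "odd d"
    and "n \<ge> 1" and "gcd d (2 ^ n - 1) = 1"
    and "1 \<le> r" and "r \<le> ord d 2 - 1" and "[n = r] (mod ord d 2)"
  shows
    "real (Inv d n) =
       real (Inv d r) * 2 ^ (n - r)
       + ((real d * real (Inv d r) - 1) / (2 ^ r - 1) - 1) * ((2 ^ (n - r) - 1) / real d)
     \<and>
     (\<exists>m::nat. real m = (real n - real r) / real (ord d 2) \<and>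
       real (Inv d n) =
         real (Inv d r) * (\<Sum>i=0..m. 2 ^ (ord d 2 * i))
         + (2 ^ (ord d 2 - r) - 1 - real (Inv d (ord d 2 - r))) * 2 ^ r
           * (\<Sum>i<m. 2 ^ (ord d 2 * i)) \<and>
       real (Inv d n) =
         real (Inv d r) * ((2 ^ (ord d 2 * (m + 1)) - 1) / (2 ^ ord d 2 - 1))
         + (2 ^ (ord d 2 - r) - 1 - real (Inv d (ord d 2 - r))) * 2 ^ r
           * ((2 ^ (ord d 2 * m) - 1) / (2 ^ ord d 2 - 1)))
     \<and>
     real (Inv d n) =
       (real (Inv d r) * (2 ^ n - 1) - (2 ^ n - 2 ^ r) / real d) / (2 ^ r - 1)"
proof -
  define \<theta> where "\<theta> = ord d 2"
  have r: "1 \<le> r" "r < \<theta>" using assms(5,6) unfolding \<theta>_def by linarith+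
  have cong_nr: "n mod \<theta> = r"
    using assms(7) r unfolding \<theta>_def cong_def by simp
  define m where "m = n div \<theta>"
  have n: "n = \<theta> * m + r"
    using cong_nr mult_div_mod_eq[of \<theta> n] unfolding m_def by simp
  define s where "s = \<theta> - r"
  have s: "1 \<le> s" "\<theta> = r + s" using r by (auto simp: s_def)

  have ord_nat: "[2 ^ \<theta> = 1] (mod d)" unfolding \<theta>_def by (rule ord)
  have T: "[2 ^ \<theta> = (1::int)] (mod int d)"
    using ord_nat by (metis cong_int_iff of_nat_1 of_nat_numeral of_nat_power)
  have "[(2 ^ \<theta>) ^ m * 2 ^ r = (1::int) ^ m * 2 ^ r] (mod int d)"
    by (intro cong_mult cong_pow T cong_refl)
  then have cong_pow: "[2 ^ n = (2::int) ^ r] (mod int d)"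
    by (simp add: n power_add power_mult)
  then have cong_minus: "[2 ^ n - 1 = (2::int) ^ r - 1] (mod int d)"
    by (intro cong_diff cong_refl)
  have cong_rs: "[2 ^ r * 2 ^ s = (1::int)] (mod int d)"
    using T by (simp add: s(2) power_add)

  have cop_n: "coprime (int d) (2 ^ n - 1)"
  proof -
    have "coprime (int d) (int (2 ^ n - 1))"
      using assms(4) by (metis coprime_iff_gcd_eq_1 coprime_int_iff)
    then show ?thesis by (simp add: of_nat_diff)
  qed
  have cop_r: "coprime (int d) (2 ^ r - 1)"
    using cong_imp_coprime[OF cong_minus] cop_n by (simp add: coprime_commute)
  \<comment> \<open>Up to the unit \<open>2 ^ r\<close>, \<open>2 ^ s - 1\<close> is \<open>1 - 2 ^ r\<close> modulo \<open>d\<close>.\<close>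
  have cop_s: "coprime (int d) (2 ^ s - 1)"
  proof -
    have "[2 ^ r * 2 ^ s - 2 ^ r = (1::int) - 2 ^ r] (mod int d)"
      by (intro cong_diff cong_rs cong_refl)
    then have "[1 - 2 ^ r = (2::int) ^ r * (2 ^ s - 1)] (mod int d)"
      by (simp add: cong_sym algebra_simps)
    moreover have "coprime (1 - 2 ^ r) (int d)"
      using cop_r by (metis coprime_commute coprime_minus_right_iff minus_diff_eq)
    ultimately have "coprime (2 ^ r * (2 ^ s - 1)) (int d)"
      by (rule cong_imp_coprime)
    then show ?thesis by (simp add: coprime_commute)
  qed

  have d2: "d \<ge> 2" using assms(1) by simp
  obtain k where k: "0 < k" "k < int d"
      "int d * int (Inv d n) = 1 + k * (2 ^ n - 1)"
    using Inv_quotient[OF d2 assms(3) cop_n] .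
  obtain k' where k': "0 < k'" "k' < int d"
      "int d * int (Inv d r) = 1 + k' * (2 ^ r - 1)"
    using Inv_quotient[OF d2 r(1) cop_r] .
  obtain l where l: "0 < l" "l < int d"
      "int d * int (Inv d s) = 1 + l * (2 ^ s - 1)"
    using Inv_quotient[OF d2 s(1) cop_s] .
  have "k = k'"
    using inverse_quotient_unique[OF k(1,2) k'(1,2) k(3) k'(3) cong_minus cop_n] .
  have "k' + l = int d + 1"
    using inverse_quotient_reflect[OF k'(1,2) l(1,2) k'(3) l(3) cong_rs cop_r] .
  then have l_eq: "l = int d + 1 - k" using \<open>k = k'\<close> by simp

  \<comment> \<open>\<open>R * X\<close> is \<open>2 ^ n\<close> and \<open>R * S\<close> is \<open>2 ^ \<theta>\<close>, so all powers in the formulas are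
    monomials in \<open>R\<close>, \<open>S\<close> and \<open>X\<close>.\<close>
  define D where "D = real d"
  define K where "K = real_of_int k"
  define R where "R = (2::real) ^ r"
  define S where "S = (2::real) ^ s"
  define X where "X = (2::real) ^ (\<theta> * m)"
  have eq_n: "D * real (Inv d n) = 1 + K * (R * X - 1)"
  proof -
    have "real_of_int (int d * int (Inv d n)) = real_of_int (1 + k * (2 ^ n - 1))"
      by (simp only: k(3))
    then show ?thesis by (simp add: D_def K_def R_def X_def n power_add mult.commute)
  qed
  have eq_r: "D * real (Inv d r) = 1 + K * (R - 1)"
  proof -
    have "real_of_int (int d * int (Inv d r)) = real_of_int (1 + k * (2 ^ r - 1))"
      using k'(3) \<open>k = k'\<close> by presburger
    then show ?thesis by (simp add: D_def K_def R_def)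
  qed
  have eq_s: "D * real (Inv d s) = 1 + (D + 1 - K) * (S - 1)"
  proof -
    have "real_of_int (int d * int (Inv d s)) = real_of_int (1 + (int d + 1 - k) * (2 ^ s - 1))"
      using l(3) l_eq by presburger
    then show ?thesis by (simp add: D_def K_def S_def)
  qed
  have D0: "D \<noteq> 0" using assms(1) by (simp add: D_def)
  have R1: "R > 1" unfolding R_def using r(1) by (intro one_less_power) auto
  have S1: "S > 1" unfolding S_def using s(1) by (intro one_less_power) auto
  have RS1: "R * S > 1" using less_1_mult[OF R1 S1] .
  have two_n: "2 ^ n = R * X" "2 ^ (n - r) = X"
    by (simp_all add: R_def X_def n power_add)
  have two_\<theta>: "2 ^ \<theta> = R * S" "2 ^ (\<theta> * (m + 1)) = R * S * X"
    by (simp_all add: R_def S_def X_def s(2) power_add algebra_simps)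
  have K_eq: "K = (D * real (Inv d r) - 1) / (R - 1)"
    using eq_r R1 by simp

  have a: "real (Inv d n) = real (Inv d r) * X
      + ((D * real (Inv d r) - 1) / (R - 1) - 1) * ((X - 1) / D)"
  proof -
    have "D * real (Inv d n) = D * real (Inv d r) * X + (K - 1) * (X - 1)"
      unfolding eq_n eq_r by (simp add: algebra_simps)
    then show ?thesis unfolding K_eq[symmetric] using D0 by (simp add: field_simps)
  qed

  have c: "real (Inv d n) =
      (real (Inv d r) * (R * X - 1) - (R * X - R) / D) / (R - 1)"
  proof -
    have "D * (real (Inv d n) * (R - 1)) = (D * real (Inv d n)) * (R - 1)" by simp
    also have "\<dots> = (D * real (Inv d r)) * (R * X - 1) - (R * X - R)"
      unfolding eq_n eq_r by (simp add: algebra_simps)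
    also have "\<dots> = D * (real (Inv d r) * (R * X - 1) - (R * X - R) / D)"
      using D0 by (simp add: field_simps)
    finally have "real (Inv d n) * (R - 1) = real (Inv d r) * (R * X - 1) - (R * X - R) / D"
      using D0 by simp
    then show ?thesis using R1 by (simp add: eq_divide_eq)
  qed

  have b: "real (Inv d n) = real (Inv d r) * ((R * S * X - 1) / (R * S - 1))
      + (S - 1 - real (Inv d s)) * R * ((X - 1) / (R * S - 1))"
  proof -
    have "D * (real (Inv d n) * (R * S - 1)) = (D * real (Inv d n)) * (R * S - 1)" by simp
    also have "\<dots> = (D * real (Inv d r)) * (R * S * X - 1)
        + (D * (S - 1) - D * real (Inv d s)) * R * (X - 1)"
      unfolding eq_n eq_r eq_s by (simp add: algebra_simps)
    also have "\<dots> = D * (real (Inv d r) * (R * S * X - 1)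
        + (S - 1 - real (Inv d s)) * R * (X - 1))"
      by (simp add: algebra_simps)
    finally have "real (Inv d n) * (R * S - 1) = real (Inv d r) * (R * S * X - 1)
        + (S - 1 - real (Inv d s)) * R * (X - 1)"
      using D0 by simp
    then have "real (Inv d n) = (real (Inv d r) * (R * S * X - 1)
        + (S - 1 - real (Inv d s)) * R * (X - 1)) / (R * S - 1)"
      using RS1 by (simp add: eq_divide_eq)
    then show ?thesis by (simp add: add_divide_distrib)
  qed

  have geometric: "(\<Sum>i<j. 2 ^ (\<theta> * i)) = (2 ^ (\<theta> * j) - 1) / ((2::real) ^ \<theta> - 1)" for j
    using RS1 geometric_sum[of "(2::real) ^ \<theta>" j] unfolding two_\<theta>(1)[symmetric]
    by (simp add: power_mult)
  have sums: "(\<Sum>i=0..m. 2 ^ (\<theta> * i)) = (R * S * X - 1) / (R * S - 1)"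
    "(\<Sum>i<m. 2 ^ (\<theta> * i)) = (X - 1) / (R * S - 1)"
    using geometric[of "m + 1"] geometric[of m]
    unfolding two_\<theta> X_def[symmetric]
    by (simp_all only: atLeast0AtMost lessThan_Suc_atMost Suc_eq_plus1[symmetric])
  have m: "real m = (real n - real r) / real \<theta>"
    using r by (simp add: n)
  show ?thesis
    unfolding \<theta>_def[symmetric] s_def[symmetric] two_n
      D_def[symmetric] R_def[symmetric] S_def[symmetric]
    using a c b m by (intro conjI exI[of _ m]) (simp_all only: sums two_\<theta> X_def[symmetric])
qed

end
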